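(* Let $T$ be a Fréchet space, $B$ and $E$ Banach spaces, $U\subset T\times B$ an open set, $f:U\to E$ a $C^1_F$-map, and $(t_0,x_0)\in U$ a zero of $f$. Assume that the partial derivative $D_2f(t_0,x_0):B\to E$ is bijective. Then there are open neighbourhoods $V$ of $t_0$ in $T$ and $W$ of $x_0$ in $B$ with $V\times W\subset U$ and a $C^1_F$-map $g:V\to W$ with $g(t_0)=x_0$ and $$\{(t,x)\in V\times W:f(t,x)=0\}=\{(t,x)\in V\times W:x=g(t)\}.$$
   Context: For topological vector spaces $V,W$, $L_c(V,W)$ denotes the vector space of continuous linear maps $V\to W$; the topology $\beta$ on $L_c(V,W)$ is that of uniform convergence on bounded sets (basic neighbourhoods of $0$: $\{A\in L_c(V,W): AB\subset N\}$ with $B\subset V$ bounded and $N$ a neighbourhood of $0$ in $W$). A continuous map $f:V\supset U\to W$, $U$ open, is $C^1_F$-smooth (a $C^1_F$-map) if all directional derivatives $Df(u)v=\lim_{0\ne t\to0}\frac1t(f(u+tv)-f(u))$, $u\in U$, $v\in V$, exist, each $Df(u):V\to W$ is linear and continuous, and $U\ni u\mapsto Df(u)\in L_c(V,W)$ is continuous with respect to $\beta$. Partial derivatives are $D_2f(t,x)\hat x=\lim_{0\ne h\to0}\frac1h(f(t,x+h\hat x)-f(t,x))$, and $D_1f$ analogously. Products carry the product topology. *)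

theory Defs
  imports "HOL-Analysis.Analysis"
begin

class real_tvs = real_vector + topological_ab_group_add +
  assumes tendsto_scaleR_Pair:
    "LIM p (nhds a \<times>\<^sub>F nhds b). fst p *\<^sub>R snd p :> nhds (a *\<^sub>R b)"

instance real_normed_vector \<subseteq> real_tvs
proof
  fix a :: real and b :: "'a::real_normed_vector"
  show "LIM p (nhds a \<times>\<^sub>F nhds b). fst p *\<^sub>R snd p :> nhds (a *\<^sub>R b)"
    unfolding nhds_prod[symmetric]
    by (intro tendsto_scaleR tendsto_fst[where a = "(a, b)", simplified]
        tendsto_snd[where a = "(a, b)", simplified] filterlim_ident)
qed

lemma continuous_on_scaleR_tvs: "continuous_on UNIV (\<lambda>(a, x). a *\<^sub>R (x::'a::real_tvs))"
proof -
  have "((\<lambda>p. fst p *\<^sub>R (snd p :: 'a)) \<longlongrightarrow> fst q *\<^sub>R snd q) (at q)" for q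
    using tendsto_scaleR_Pair[of "fst q" "snd q"]
    by (intro filterlim_mono[OF _ order_refl at_within_le_nhds]) (simp flip: nhds_prod)
  then show ?thesis
    by (simp add: continuous_on_def case_prod_beta)
qed

instance prod :: (topological_monoid_add, topological_monoid_add) topological_monoid_add
proof
  fix a b :: "'a \<times> 'b"
  have "((\<lambda>p. (fst (fst p) + fst (snd p), snd (fst p) + snd (snd p))) \<longlongrightarrow>
      (fst a + fst b, snd a + snd b)) (nhds (a, b))"
    by (intro tendsto_Pair tendsto_add)
      (auto intro!: tendsto_eq_intros filterlim_ident)
  then show "LIM x (nhds a \<times>\<^sub>F nhds b). fst x + snd x :> nhds (a + b)"
    by (simp add: nhds_prod plus_prod_def)
qed

instance prod :: (topological_group_add, topological_group_add) topological_group_add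
proof
  fix a :: "'a \<times> 'b"
  have "((\<lambda>p. (- fst p, - snd p)) \<longlongrightarrow> (- fst a, - snd a)) (nhds a)"
    by (auto intro!: tendsto_eq_intros filterlim_ident)
  then show "(uminus \<longlongrightarrow> - a) (nhds a)"
    by (simp add: uminus_prod_def[abs_def])
qed

instance prod :: (topological_ab_group_add, topological_ab_group_add) topological_ab_group_add ..

instance prod :: (real_tvs, real_tvs) real_tvs
proof
  fix a :: real and b :: "'a \<times> 'b"
  have 1: "((\<lambda>p. fst p *\<^sub>R snd p) \<longlongrightarrow> r *\<^sub>R x) (nhds (r, x))"
    for r and x :: "'c::real_tvs"
    using tendsto_scaleR_Pair[of r x] by (simp add: nhds_prod)
  have 2: "((\<lambda>p. fst p *\<^sub>R h (snd p)) \<longlongrightarrow> a *\<^sub>R h b) (nhds (a, b))"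
    if "(h \<longlongrightarrow> h b) (nhds b)" for h :: "'a \<times> 'b \<Rightarrow> 'd::real_tvs"
  proof -
    have "((\<lambda>p. (fst p, h (snd p))) \<longlongrightarrow> (a, h b)) (nhds (a, b))"
      by (intro tendsto_Pair filterlim_compose[OF that])
        (auto intro!: tendsto_eq_intros filterlim_ident)
    from filterlim_compose[OF 1 this] show ?thesis by simp
  qed
  have "((\<lambda>p. (fst p *\<^sub>R fst (snd p), fst p *\<^sub>R snd (snd p))) \<longlongrightarrow>
      (a *\<^sub>R fst b, a *\<^sub>R snd b)) (nhds (a, b))"
    by (intro tendsto_Pair 2) (auto intro!: tendsto_eq_intros filterlim_ident)
  then show "LIM p (nhds a \<times>\<^sub>F nhds b). fst p *\<^sub>R snd p :> nhds (a *\<^sub>R b)"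
    by (simp add: nhds_prod scaleR_prod_def)
qed

text \<open>A Fr\'echet space is a locally convex space whose topology is induced by a complete
  translation-invariant metric.\<close>

class frechet_space = real_tvs +
  assumes locally_convex_ax:
    "open N \<Longrightarrow> 0 \<in> N \<Longrightarrow> \<exists>C. open C \<and>
       (\<forall>x\<in>C. \<forall>y\<in>C. \<forall>u\<ge>0. \<forall>v\<ge>0. u + v = 1 \<longrightarrow> u *\<^sub>R x + v *\<^sub>R y \<in> C) \<and> 0 \<in> C \<and> C \<subseteq> N"
  assumes complete_invariant_metric:
    "\<exists>d. Metric_space UNIV d \<and> (\<forall>x y z. d (x + z) (y + z) = d x y) \<and>
       Metric_space.mtopology UNIV d = topology open \<and> Metric_space.mcomplete UNIV d"

lemma locally_convex:
  fixes N :: "'a::frechet_space set"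
  assumes "open N" "0 \<in> N"
  shows "\<exists>C. open C \<and> convex C \<and> 0 \<in> C \<and> C \<subseteq> N"
  using locally_convex_ax[OF assms] by (auto simp: convex_def)

text \<open>Boundedness is meant in the sense of topological vector spaces (absorbed by every
  neighbourhood of zero); in a normed space this is \<^const>\<open>bounded\<close>.\<close>

definition tvs_bounded :: "'a::real_tvs set \<Rightarrow> bool" where
  "tvs_bounded B \<longleftrightarrow>
     (\<forall>N. open N \<and> 0 \<in> N \<longrightarrow> (\<exists>s>0. \<forall>r. \<bar>r\<bar> \<ge> s \<longrightarrow> B \<subseteq> (\<lambda>x. r *\<^sub>R x) ` N))"

lemma tvs_bounded_Un: "tvs_bounded A \<Longrightarrow> tvs_bounded B \<Longrightarrow> tvs_bounded (A \<union> B)"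
  unfolding tvs_bounded_def
proof (intro allI impI)
  fix N :: "'a set"
  assume A: "\<forall>N. open N \<and> 0 \<in> N \<longrightarrow> (\<exists>s>0. \<forall>r. \<bar>r\<bar> \<ge> s \<longrightarrow> A \<subseteq> (\<lambda>x. r *\<^sub>R x) ` N)"
    and B: "\<forall>N. open N \<and> 0 \<in> N \<longrightarrow> (\<exists>s>0. \<forall>r. \<bar>r\<bar> \<ge> s \<longrightarrow> B \<subseteq> (\<lambda>x. r *\<^sub>R x) ` N)"
    and N: "open N \<and> 0 \<in> N"
  obtain s s' where s: "s > 0" "\<And>r. \<bar>r\<bar> \<ge> s \<Longrightarrow> A \<subseteq> (\<lambda>x. r *\<^sub>R x) ` N"
    and s': "s' > 0" "\<And>r. \<bar>r\<bar> \<ge> s' \<Longrightarrow> B \<subseteq> (\<lambda>x. r *\<^sub>R x) ` N"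
    using A[rule_format, OF N] B[rule_format, OF N] by blast
  have "A \<union> B \<subseteq> (\<lambda>x. r *\<^sub>R x) ` N" if "\<bar>r\<bar> \<ge> max s s'" for r
    using s(2)[of r] s'(2)[of r] that by simp
  then show "\<exists>s>0. \<forall>r. \<bar>r\<bar> \<ge> s \<longrightarrow> A \<union> B \<subseteq> (\<lambda>x. r *\<^sub>R x) ` N"
    using s(1) by (intro exI[of _ "max s s'"]) auto
qed

lemma tvs_bounded_empty: "tvs_bounded {}"
  unfolding tvs_bounded_def by (auto intro!: exI[of _ 1])

definition cont_linear_maps :: "('a::real_tvs \<Rightarrow> 'b::real_tvs) set" where
  "cont_linear_maps = {A. linear A \<and> continuous_on UNIV A}"

definition beta_nhd :: "'a set \<Rightarrow> 'b set \<Rightarrow> ('a::real_tvs \<Rightarrow> 'b::real_tvs) set" where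
  "beta_nhd B N = {A \<in> cont_linear_maps. A ` B \<subseteq> N}"

definition beta_open :: "('a::real_tvs \<Rightarrow> 'b::real_tvs) set \<Rightarrow> bool" where
  "beta_open G \<longleftrightarrow> G \<subseteq> cont_linear_maps \<and>
     (\<forall>A\<in>G. \<exists>B N. tvs_bounded B \<and> open N \<and> 0 \<in> N \<and>
        {A' \<in> cont_linear_maps. (\<lambda>v. A' v - A v) \<in> beta_nhd B N} \<subseteq> G)"

definition beta_topology :: "('a::real_tvs \<Rightarrow> 'b::real_tvs) topology" where
  "beta_topology = topology beta_open"

lemma istopology_beta_open: "istopology beta_open"
  unfolding istopology_def
proof (intro conjI allI impI)
  fix G H :: "('a \<Rightarrow> 'b) set"
  assume G: "beta_open G" and H: "beta_open H"
  show "beta_open (G \<inter> H)"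
    unfolding beta_open_def
  proof (intro conjI ballI)
    show "G \<inter> H \<subseteq> cont_linear_maps" using G by (auto simp: beta_open_def)
    fix A assume A: "A \<in> G \<inter> H"
    obtain B N where 1: "tvs_bounded B" "open N" "0 \<in> N"
      "{A' \<in> cont_linear_maps. (\<lambda>v. A' v - A v) \<in> beta_nhd B N} \<subseteq> G"
      using G A unfolding beta_open_def by blast
    obtain C M where 2: "tvs_bounded C" "open M" "0 \<in> M"
      "{A' \<in> cont_linear_maps. (\<lambda>v. A' v - A v) \<in> beta_nhd C M} \<subseteq> H"
      using H A unfolding beta_open_def by blast
    have "beta_nhd (B \<union> C) (N \<inter> M) \<subseteq> beta_nhd B N \<inter> beta_nhd C M"
      by (auto simp: beta_nhd_def)
    then have "{A' \<in> cont_linear_maps. (\<lambda>v. A' v - A v) \<in> beta_nhd (B \<union> C) (N \<inter> M)} \<subseteq> G \<inter> H"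
      using 1(4) 2(4) by blast
    then show "\<exists>B N. tvs_bounded B \<and> open N \<and> 0 \<in> N \<and>
        {A' \<in> cont_linear_maps. (\<lambda>v. A' v - A v) \<in> beta_nhd B N} \<subseteq> G \<inter> H"
      using 1 2 by (intro exI[of _ "B \<union> C"] exI[of _ "N \<inter> M"]) (auto simp: tvs_bounded_Un)
  qed
next
  fix \<K> :: "('a \<Rightarrow> 'b) set set"
  assume K: "\<forall>K\<in>\<K>. beta_open K"
  show "beta_open (\<Union>\<K>)"
    unfolding beta_open_def
  proof (intro conjI ballI)
    show "\<Union>\<K> \<subseteq> cont_linear_maps" using K by (auto simp: beta_open_def)
    fix A assume "A \<in> \<Union>\<K>"
    then obtain G where G: "G \<in> \<K>" "A \<in> G" by blast
    then obtain B N where "tvs_bounded B" "open N" "0 \<in> N"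
      "{A' \<in> cont_linear_maps. (\<lambda>v. A' v - A v) \<in> beta_nhd B N} \<subseteq> G"
      using K unfolding beta_open_def by blast
    then show "\<exists>B N. tvs_bounded B \<and> open N \<and> 0 \<in> N \<and>
        {A' \<in> cont_linear_maps. (\<lambda>v. A' v - A v) \<in> beta_nhd B N} \<subseteq> \<Union>\<K>"
      using G(1) by blast
  qed
qed

lemma openin_beta_topology: "openin beta_topology = beta_open"
  unfolding beta_topology_def using istopology_beta_open by (rule topology_inverse')

lemma topspace_beta_topology: "topspace beta_topology = cont_linear_maps"
proof -
  have "beta_open cont_linear_maps"
    unfolding beta_open_def
    using tvs_bounded_empty by (intro conjI ballI exI[of _ "{}"] exI[of _ UNIV]) auto
  then show ?thesis
    unfolding topspace_def openin_beta_topology beta_open_def by blast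
qed

definition has_dir_deriv ::
    "('a::real_tvs \<Rightarrow> 'b::{real_tvs,t2_space}) \<Rightarrow> 'a \<Rightarrow> 'a \<Rightarrow> 'b \<Rightarrow> bool" where
  "has_dir_deriv f u v w \<longleftrightarrow> ((\<lambda>t::real. (1 / t) *\<^sub>R (f (u + t *\<^sub>R v) - f u)) \<longlongrightarrow> w) (at 0)"

text \<open>As with \<^const>\<open>Lim\<close>, the value is meaningful only where the limit exists.\<close>

definition dir_deriv ::
    "('a::real_tvs \<Rightarrow> 'b::{real_tvs,t2_space}) \<Rightarrow> 'a \<Rightarrow> 'a \<Rightarrow> 'b" where
  "dir_deriv f u v = Lim (at 0) (\<lambda>t::real. (1 / t) *\<^sub>R (f (u + t *\<^sub>R v) - f u))"

definition partial_deriv2 ::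
    "('a::real_tvs \<times> 'b::real_tvs \<Rightarrow> 'c::{real_tvs,t2_space}) \<Rightarrow> 'a \<Rightarrow> 'b \<Rightarrow> 'b \<Rightarrow> 'c" where
  "partial_deriv2 f t x x' = Lim (at 0) (\<lambda>h::real. (1 / h) *\<^sub>R (f (t, x + h *\<^sub>R x') - f (t, x)))"

text \<open>Only the values of \<open>f\<close> on the open set \<open>U\<close> matter: for \<open>u \<in> U\<close> the point
  \<open>u + t v\<close> lies in \<open>U\<close> for all small \<open>t\<close>.\<close>

definition C1F_on ::
    "'a::real_tvs set \<Rightarrow> ('a \<Rightarrow> 'b::{real_tvs,t2_space}) \<Rightarrow> bool" where
  "C1F_on U f \<longleftrightarrow> open U \<and> continuous_on U f \<and>
     (\<forall>u\<in>U. \<forall>v. \<exists>w. has_dir_deriv f u v w) \<and>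
     (\<forall>u\<in>U. linear (dir_deriv f u) \<and> continuous_on UNIV (dir_deriv f u)) \<and>
     continuous_map (top_of_set U) beta_topology (dir_deriv f)"

end

theory Submission
  imports Defs
begin

text \<open>Composing \<open>f\<close> with the inverse of the partial derivative \<open>D\<^sub>2 f (t\<^sub>0, x\<^sub>0)\<close>, which is bounded
  by Banach's theorem, one may assume that \<open>E = B\<close> and \<open>D\<^sub>2 f (t\<^sub>0, x\<^sub>0) = id\<close>. Uniformity of the
  derivative on the bounded unit ball of \<open>B\<close> makes \<open>x \<mapsto> x - f (t, x)\<close> a contraction of constant
  \<open>1/2\<close> near \<open>x\<^sub>0\<close>, uniformly in \<open>t\<close> near \<open>t\<^sub>0\<close>; its fixed point is \<open>g t\<close>. The derivative
  \<open>w = Dg(t)v\<close> is the solution of \<open>Df (t, g t) (v, w) = 0\<close>. Its continuity in \<open>t\<close> with respect to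
  \<open>\<beta>\<close> follows because \<open>v \<mapsto> (v, Dg(t)v)\<close> maps bounded sets to bounded sets.\<close>

section \<open>Continuous linear maps between Banach spaces and the bounded inverse theorem\<close>

lemma bounded_linear_surj_approx:
  fixes A :: "'a::banach \<Rightarrow> 'b::banach"
  assumes "bounded_linear A" "surj A"
  obtains K where "K > 0" "\<And>y e. e > 0 \<Longrightarrow> \<exists>x. norm x \<le> K * norm y \<and> norm (A x - y) < e"
proof -
  interpret A: bounded_linear A by fact
  \<comment> \<open>By surjectivity these closed sets cover the codomain, which is complete, so by
    Baire one of them contains a ball. The ball need not be centred at 0.\<close>
  define S where "S n = closure (A ` ball 0 (real n))" for n
  have UN: "\<Union>(range S) = UNIV"
  proof -
    have "y \<in> \<Union>(range S)" for y
    proof -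
      obtain x where x: "y = A x" using \<open>surj A\<close> by (meson surjD)
      obtain n where "norm x < real n" using reals_Archimedean2 by blast
      then have "y \<in> S n" using closure_subset by (force simp: S_def x)
      then show ?thesis by blast
    qed
    then show ?thesis by blast
  qed
  have "\<exists>n. interior (S n) \<noteq> {}"
  proof (rule ccontr)
    assume "\<not> ?thesis"
    then have "euclidean interior_of \<Union>(range S) = {}"
      by (intro Baire_category_alt disjI1 completely_metrizable_space_euclidean)
        (auto simp: S_def)
    then show False by (simp add: UN)
  qed
  then obtain n y0 d where d: "d > 0" "ball y0 d \<subseteq> S n"
    by (metis all_not_in_conv mem_interior)
  \<comment> \<open>Recentring at 0: \<open>y\<close> is the difference of \<open>y0 + y\<close> and
    \<open>y0\<close>, both in \<open>S n\<close>. Subtracting approximate preimages of norm below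
    \<open>n\<close> gives one of norm below \<open>2 * n\<close>.\<close>
  have near: "\<exists>x. norm x < 2 * real n \<and> norm (A x - y) < e" if "norm y < d" "e > 0" for y e
  proof -
    have "y0 + y \<in> S n" "y0 \<in> S n" using d that by (auto simp: dist_norm)
    then obtain x x' where x: "norm x < real n" "dist (A x) (y0 + y) < e/2"
      and x': "norm x' < real n" "dist (A x') y0 < e/2"
      unfolding S_def closure_approachable using half_gt_zero[OF \<open>e > 0\<close>]
      by (auto dest!: spec[of _ "e / 2"])
    have "norm (x - x') < 2 * real n"
      using norm_triangle_ineq4[of x x'] x(1) x'(1) by linarith
    moreover have "norm (A (x - x') - y) < e"
      using norm_triangle_ineq4[of "A x - (y0 + y)" "A x' - y0"] x(2) x'(2)
      by (simp add: A.diff dist_norm algebra_simps)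
    ultimately show ?thesis by blast
  qed
  have n: "real n > 0"
    using near[of 0 1] d(1) by (auto intro: ccontr)
  show thesis
  proof
    show "4 * real n / d > 0" using n d by simp
    fix y :: 'b and e :: real assume e: "e > 0"
    show "\<exists>x. norm x \<le> 4 * real n / d * norm y \<and> norm (A x - y) < e"
    proof (cases "y = 0")
      case True
      then show ?thesis using e by (intro exI[of _ 0]) (simp add: A.zero)
    next
      case False
      \<comment> \<open>Scales \<open>y\<close> to norm \<open>d / 2\<close>, inside the range of
        \<open>near\<close>. The tolerance \<open>e * c\<close> becomes \<open>e\<close> after
        scaling back.\<close>
      define c where "c = d / (2 * norm y)"
      have c: "c > 0" using False d by (simp add: c_def)
      have "norm (c *\<^sub>R y) < d" using False d by (simp add: c_def)
      then obtain x where x: "norm x < 2 * real n" "norm (A x - c *\<^sub>R y) < e * c"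
        using near[of "c *\<^sub>R y" "e * c"] e c by auto
      have "norm (x /\<^sub>R c) \<le> 4 * real n / d * norm y"
        using x(1) c False d by (simp add: c_def field_simps)
      moreover have "A (x /\<^sub>R c) - y = (A x - c *\<^sub>R y) /\<^sub>R c"
        using c by (simp add: A.scaleR algebra_simps)
      then have "norm (A (x /\<^sub>R c) - y) = norm (A x - c *\<^sub>R y) / c"
        using c by (simp only: norm_scaleR) (simp add: field_simps)
      then have "norm (A (x /\<^sub>R c) - y) < e"
        using x(2) c by (simp add: pos_divide_less_eq)
      ultimately show ?thesis by blast
    qed
  qed
qed

text \<open>Successive approximation: solving up to half the norm of the right-hand side and
  repeating this on the residual makes the residuals decay geometrically. Completeness of the domain
  lets the corrections sum to an exact solution, and the geometric series contributes the factor
  2.\<close>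

lemma bounded_linear_surj_bound:
  fixes A :: "'a::banach \<Rightarrow> 'b::banach"
  assumes "bounded_linear A" "surj A"
  obtains K where "\<And>y. \<exists>x. A x = y \<and> norm x \<le> K * norm y"
proof -
  interpret A: bounded_linear A by fact
  obtain K where K: "K > 0" "\<And>y e. e > 0 \<Longrightarrow> \<exists>x. norm x \<le> K * norm y \<and> norm (A x - y) < e"
    using bounded_linear_surj_approx[OF assms] by blast
  have "\<exists>x. norm x \<le> K * norm y \<and> norm (A x - y) \<le> norm y / 2" for y
  proof (cases "y = 0")
    case True
    then show ?thesis by (intro exI[of _ 0]) (simp add: A.zero)
  next
    case False
    then show ?thesis using K(2)[of "norm y / 2" y] by force
  qed
  then obtain h where h: "\<And>y. norm (h y) \<le> K * norm y" "\<And>y. norm (A (h y) - y) \<le> norm y / 2"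
    by metis
  have "\<exists>x. A x = y \<and> norm x \<le> K * 2 * norm y" for y
  proof -
    \<comment> \<open>The residual left after \<open>n\<close> corrections; the correction made at
      stage \<open>n\<close> is \<open>h (r n)\<close>.\<close>
    define r where "r n = ((\<lambda>z. z - A (h z)) ^^ n) y" for n
    have r0: "r 0 = y" and rS: "\<And>n. r (Suc n) = r n - A (h (r n))" by (simp_all add: r_def)
    have r: "norm (r n) \<le> norm y * (1/2) ^ n" for n
    proof (induction n)
      case (Suc n)
      then show ?case using h(2)[of "r n"] by (simp add: rS norm_minus_commute)
    qed (simp add: r0)
    have bd: "norm (h (r n)) \<le> K * norm y * (1/2) ^ n" for n
      using order_trans[OF h(1) mult_left_mono[OF r less_imp_le[OF K(1)]]] by (simp add: mult.assoc)
    have geo: "(\<lambda>n. K * norm y * (1/2::real) ^ n) sums (K * norm y * 2)"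
      using sums_mult[OF geometric_sums[of "1/2::real"], of "K * norm y"] by simp
    have sm: "summable (\<lambda>n. h (r n))"
      by (rule summable_comparison_test'[OF sums_summable[OF geo]]) (use bd in auto)
    have "norm (\<Sum>n. h (r n)) \<le> K * norm y * 2"
      using norm_suminf_le[OF bd sums_summable[OF geo]] sums_unique[OF geo] by simp
    moreover have "A (\<Sum>n. h (r n)) = y"
    proof -
      have "(\<lambda>n. A (h (r n))) sums A (\<Sum>n. h (r n))"
        by (rule A.sums[OF summable_sums[OF sm]])
      moreover have "(\<lambda>n. A (h (r n))) sums y"
      proof -
        have "(\<lambda>n. norm y * (1/2) ^ n) \<longlonglongrightarrow> 0"
          using tendsto_mult_right_zero[OF LIMSEQ_power_zero[of "1/2::real"], of "norm y"] by simp
        then have "r \<longlonglongrightarrow> 0"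
          by (rule Lim_null_comparison[rotated]) (use r in auto)
        from telescope_sums'[OF this] show ?thesis by (simp add: rS r0)
      qed
      ultimately show ?thesis by (rule sums_unique2)
    qed
    ultimately show ?thesis by (auto simp: mult_ac)
  qed
  then show thesis using that by blast
qed

theorem bounded_linear_inv:
  fixes A :: "'a::banach \<Rightarrow> 'b::banach"
  assumes "bounded_linear A" "bij A"
  shows "bounded_linear (inv A)"
proof -
  interpret A: bounded_linear A by fact
  note A_inv = surj_f_inv_f[OF bij_is_surj[OF assms(2)]]
  note inv_eq = inv_f_eq[OF bij_is_inj[OF assms(2)]]
  obtain K where K: "\<And>y. \<exists>x. A x = y \<and> norm x \<le> K * norm y"
    using bounded_linear_surj_bound[OF assms(1) bij_is_surj[OF assms(2)]] by blast
  show ?thesis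
  proof (rule bounded_linear_intro)
    show "inv A (x + y) = inv A x + inv A y" for x y
      by (rule inv_eq) (simp add: A.add A_inv)
    show "inv A (c *\<^sub>R x) = c *\<^sub>R inv A x" for c x
      by (rule inv_eq) (simp add: A.scaleR A_inv)
    show "norm (inv A y) \<le> norm y * K" for y
      using K[of y] inv_eq by (metis mult.commute)
  qed
qed

text \<open>Passes from the topological notion of continuous linear map behind \<open>C1F_on\<close>
  to the one for which the bounded inverse theorem is stated. Continuity at 0 with tolerance 1
  suffices, by homogeneity.\<close>

lemma linear_continuous_imp_bounded_linear:
  fixes A :: "'a::real_normed_vector \<Rightarrow> 'b::real_normed_vector"
  assumes lin: "linear A" and cont: "continuous_on UNIV A"
  shows "bounded_linear A"
proof -
  have "isCont A 0" using cont by (simp add: continuous_on_eq_continuous_at)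
  then obtain d where d: "d > 0" "\<And>x. norm x < d \<Longrightarrow> norm (A x) < 1"
    unfolding continuous_at_eps_delta using linear_0[OF lin] by (metis diff_zero dist_norm zero_less_one)
  have "norm (A x) \<le> norm x * (2 / d)" for x
  proof (cases "x = 0")
    case False
    define c where "c = d / (2 * norm x)"
    have c: "c > 0" using False d(1) by (simp add: c_def)
    have "norm (c *\<^sub>R x) < d" using False d(1) by (simp add: c_def)
    from d(2)[OF this] have "c * norm (A x) < 1" using c by (simp add: linear_scale[OF lin])
    then have "norm (A x) < 1 / c" using c by (simp add: field_simps)
    also have "1 / c = norm x * (2 / d)" by (simp add: c_def)
    finally show ?thesis by simp
  qed (simp add: linear_0[OF lin])
  then show ?thesis
    using linear_add[OF lin] linear_scale[OF lin] by (intro bounded_linear_intro)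
qed

section \<open>Directional derivatives along lines and the mean value estimate\<close>

lemma tendsto_scaleR_tvs:
  fixes b :: "'a::real_tvs"
  assumes "(f \<longlongrightarrow> a) F" "(g \<longlongrightarrow> b) F"
  shows "((\<lambda>x. f x *\<^sub>R g x) \<longlongrightarrow> a *\<^sub>R b) F"
proof -
  have "((\<lambda>x. (f x, g x)) \<longlongrightarrow> (a, b)) F" by (intro tendsto_Pair assms)
  then have "filterlim (\<lambda>x. (f x, g x)) (nhds a \<times>\<^sub>F nhds b) F" by (simp add: nhds_prod)
  from filterlim_compose[OF tendsto_scaleR_Pair this] show ?thesis by simp
qed

lemma tendsto_line:
  fixes u v :: "'a::real_tvs"
  shows "((\<lambda>s. u + s *\<^sub>R v) \<longlongrightarrow> u + s0 *\<^sub>R v) (nhds s0)"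
  by (intro tendsto_add tendsto_const tendsto_scaleR_tvs filterlim_ident)

lemma eventually_line:
  fixes u v :: "'a::real_tvs"
  assumes "eventually P (nhds u)"
  shows "\<forall>\<^sub>F h in at 0. P (u + h *\<^sub>R v)"
proof -
  have "((\<lambda>s. u + s *\<^sub>R v) \<longlongrightarrow> u) (at 0)"
    using filterlim_mono[OF tendsto_line[of u v 0] order_refl at_within_le_nhds] by simp
  then show ?thesis using assms by (rule filterlim_iff[THEN iffD1, rule_format])
qed

lemma dir_deriv_eq: "has_dir_deriv f u v w \<Longrightarrow> dir_deriv f u v = w"
  unfolding has_dir_deriv_def dir_deriv_def by (intro tendsto_Lim) auto

text \<open>Restriction to a line reduces to calculus in one real variable, which is available
  although the domain carries no norm.\<close>

lemma has_vector_derivative_line: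
  fixes f :: "'a::real_tvs \<Rightarrow> 'b::real_normed_vector"
  assumes "has_dir_deriv f (u + s *\<^sub>R v) v w"
  shows "((\<lambda>s. f (u + s *\<^sub>R v)) has_vector_derivative w) (at s)"
proof -
  have *: "((\<lambda>h. (1 / h) *\<^sub>R (f (u + (s + h) *\<^sub>R v) - f (u + s *\<^sub>R v)) - w) \<longlongrightarrow> 0) (at 0)"
    using assms unfolding has_dir_deriv_def
    by (subst LIM_zero_iff) (simp add: algebra_simps)
  have "norm (f (u + (s + h) *\<^sub>R v) - f (u + s *\<^sub>R v) - h *\<^sub>R w) / norm h =
     norm ((1 / h) *\<^sub>R (f (u + (s + h) *\<^sub>R v) - f (u + s *\<^sub>R v)) - w)" if "h \<noteq> 0" for h
  proof -
    have "(1 / h) *\<^sub>R (f (u + (s + h) *\<^sub>R v) - f (u + s *\<^sub>R v)) - w =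
      (1 / h) *\<^sub>R (f (u + (s + h) *\<^sub>R v) - f (u + s *\<^sub>R v) - h *\<^sub>R w)"
      using that by (simp add: scaleR_diff_right)
    then show ?thesis by simp
  qed
  then have "((\<lambda>h. norm (f (u + (s + h) *\<^sub>R v) - f (u + s *\<^sub>R v) - h *\<^sub>R w) / norm h) \<longlongrightarrow> 0) (at 0)"
    by (intro Lim_transform_eventually[OF tendsto_norm_zero[OF *]]) (auto simp: eventually_at_filter)
  then show ?thesis
    unfolding has_vector_derivative_def has_derivative_at
    by (simp add: bounded_linear_scaleR_left)
qed

text \<open>The mean value inequality on the unit interval, applied to \<open>f\<close> along the
  segment minus \<open>s *\<^sub>R l\<close>. The subtracted term has constant derivative
  \<open>l\<close>, so closeness of the derivatives to \<open>l\<close> passes to the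
  increment.\<close>

lemma mean_value_estimate:
  fixes f :: "'a::real_tvs \<Rightarrow> 'b::real_normed_vector"
  assumes "\<And>s. s \<in> {0..1} \<Longrightarrow> has_dir_deriv f (u + s *\<^sub>R v) v (D s)"
    and "\<And>s. s \<in> {0..1} \<Longrightarrow> norm (D s - l) \<le> c"
  shows "norm (f (u + v) - f u - l) \<le> c"
proof -
  define \<phi> where "\<phi> s = f (u + s *\<^sub>R v) - s *\<^sub>R l" for s :: real
  have "norm (\<phi> 1 - \<phi> 0) \<le> c * norm (1 - 0 :: real)"
  proof (rule differentiable_bound)
    fix s :: real assume s: "s \<in> {0..1}"
    have "(\<phi> has_vector_derivative (D s - l)) (at s within {0..1})"
      unfolding \<phi>_def
      by (rule has_vector_derivative_at_within, rule has_vector_derivative_diff,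
          rule has_vector_derivative_line, rule assms(1)[OF s])
        (auto simp: has_vector_derivative_def intro!: derivative_eq_intros)
    then show "(\<phi> has_derivative (\<lambda>h. h *\<^sub>R (D s - l))) (at s within {0..1})"
      by (simp add: has_vector_derivative_def)
    show "onorm (\<lambda>h. h *\<^sub>R (D s - l)) \<le> c"
      using assms(2)[OF s] by (intro onorm_le) (auto simp: mult.commute[of c] mult_left_mono)
  qed auto
  then show ?thesis by (simp add: \<phi>_def algebra_simps)
qed

section \<open>Bounded sets and continuity with respect to \<beta>\<close>

lemma tvs_bounded_image:
  fixes A :: "'a::real_tvs \<Rightarrow> 'b::real_tvs"
  assumes "linear A" "continuous_on UNIV A" "tvs_bounded B"
  shows "tvs_bounded (A ` B)"
  unfolding tvs_bounded_def
proof (intro allI impI)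
  fix N :: "'b set" assume N: "open N \<and> 0 \<in> N"
  have "open (A -` N)" "0 \<in> A -` N"
    using N assms(1,2) by (auto intro: open_vimage simp: linear_0)
  then obtain s where s: "s > 0" "\<And>r. \<bar>r\<bar> \<ge> s \<Longrightarrow> B \<subseteq> (\<lambda>x. r *\<^sub>R x) ` (A -` N)"
    using assms(3) unfolding tvs_bounded_def by blast
  have "A ` B \<subseteq> (\<lambda>x. r *\<^sub>R x) ` N" if r: "\<bar>r\<bar> \<ge> s" for r
  proof
    fix y assume "y \<in> A ` B"
    then obtain x where "y = A (r *\<^sub>R x)" "A x \<in> N" using s(2)[OF r] by blast
    then show "y \<in> (\<lambda>x. r *\<^sub>R x) ` N" by (auto simp: linear_scale[OF assms(1)])
  qed
  then show "\<exists>s>0. \<forall>r. \<bar>r\<bar> \<ge> s \<longrightarrow> A ` B \<subseteq> (\<lambda>x. r *\<^sub>R x) ` N" using s(1) by blast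
qed

text \<open>Makes the unit ball an admissible test set for \<beta>, so that \<beta>-continuity
  yields operator norm estimates in the Banach direction.\<close>

lemma tvs_bounded_cball: "tvs_bounded (cball (0::'a::real_normed_vector) 1)"
  unfolding tvs_bounded_def
proof (intro allI impI)
  fix N :: "'a set" assume "open N \<and> 0 \<in> N"
  then obtain e where e: "e > 0" "ball 0 e \<subseteq> N" by (meson openE)
  have "x \<in> (\<lambda>x. r *\<^sub>R x) ` N" if r: "\<bar>r\<bar> \<ge> 2 / e" and x: "norm x \<le> 1" for r and x :: 'a
  proof
    have "2 / e > 0" using e(1) by simp
    then have r0: "\<bar>r\<bar> > 0" using r by linarith
    then show "x = r *\<^sub>R (x /\<^sub>R r)" by simp
    have "1 < e * \<bar>r\<bar>" using r e(1) by (simp add: field_simps)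
    then have "norm (x /\<^sub>R r) < e" using x r0 by (simp add: field_simps)
    then show "x /\<^sub>R r \<in> N" using e(2) by auto
  qed
  then show "\<exists>s>0. \<forall>r. \<bar>r\<bar> \<ge> s \<longrightarrow> cball 0 1 \<subseteq> (\<lambda>x. r *\<^sub>R x) ` N"
    using e(1) by (intro exI[of _ "2 / e"]) auto
qed

lemma cont_linear_maps_diff:
  "A \<in> cont_linear_maps \<Longrightarrow> A' \<in> cont_linear_maps \<Longrightarrow> (\<lambda>v. A v - A' v) \<in> cont_linear_maps"
  unfolding cont_linear_maps_def
  by (auto intro!: linear_compose_sub continuous_on_diff)

text \<open>Replaces the open sets of \<beta> by uniform norm estimates on bounded sets; this is the
  form used for every derivative below.\<close>

lemma continuous_map_beta_iff:
  fixes D :: "'c::topological_space \<Rightarrow> 'a::real_tvs \<Rightarrow> 'b::real_normed_vector"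
  assumes U: "open U" and D: "\<And>u. u \<in> U \<Longrightarrow> D u \<in> cont_linear_maps"
  shows "continuous_map (top_of_set U) beta_topology D \<longleftrightarrow>
    (\<forall>u\<in>U. \<forall>B e. tvs_bounded B \<longrightarrow> e > 0 \<longrightarrow>
      (\<forall>\<^sub>F u' in nhds u. \<forall>v\<in>B. norm (D u' v - D u v) < e))" (is "?L \<longleftrightarrow> ?R")
proof
  assume L: ?L
  show ?R
  proof (intro ballI allI impI)
    fix u and B :: "'a set" and e :: real assume u: "u \<in> U" and B: "tvs_bounded B" and e: "e > 0"
    \<comment> \<open>The uniform slack \<open>e' < e\<close> is what makes \<open>G\<close> open.
      With only a strict bound at each point of \<open>B\<close>, the supremum over \<open>B\<close>
      could equal \<open>e\<close> and leave no room around \<open>A\<close>.\<close>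
    define G where "G = {A \<in> cont_linear_maps. \<exists>e'<e. \<forall>v\<in>B. norm (A v - D u v) \<le> e'}"
    have "beta_open G"
      unfolding beta_open_def
    proof (intro conjI ballI)
      fix A assume "A \<in> G"
      then obtain e' where e': "e' < e" "\<And>v. v \<in> B \<Longrightarrow> norm (A v - D u v) \<le> e'"
        unfolding G_def by blast
      define d where "d = (e - e') / 2"
      have "A' \<in> G" if A': "A' \<in> cont_linear_maps" "(\<lambda>v. A' v - A v) \<in> beta_nhd B (ball 0 d)" for A'
      proof -
        have "norm (A' v - D u v) \<le> d + e'" if "v \<in> B" for v
        proof -
          have "norm (A' v - A v) < d" using A'(2) that unfolding beta_nhd_def by auto
          then show ?thesis
            using norm_triangle_ineq[of "A' v - A v" "A v - D u v"] e'(2)[OF that] by simp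
        qed
        moreover have "d + e' < e" using e'(1) by (simp add: d_def field_simps)
        ultimately show ?thesis using A'(1) unfolding G_def by blast
      qed
      moreover have "open (ball (0::'b) d)" "(0::'b) \<in> ball 0 d"
        using e'(1) by (auto simp: d_def)
      ultimately show "\<exists>B N. tvs_bounded B \<and> open N \<and> 0 \<in> N \<and>
          {A' \<in> cont_linear_maps. (\<lambda>v. A' v - A v) \<in> beta_nhd B N} \<subseteq> G"
        using B by blast
    qed (auto simp: G_def)
    then have "openin (top_of_set U) {x \<in> U. D x \<in> G}"
      using openin_continuous_map_preimage[OF L] by (simp add: openin_beta_topology)
    then have "open {x \<in> U. D x \<in> G}" using U openin_open_eq by blast
    moreover have "u \<in> {x \<in> U. D x \<in> G}"
      using u D e by (auto simp: G_def intro!: exI[of _ 0])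
    ultimately have "\<forall>\<^sub>F u' in nhds u. u' \<in> {x \<in> U. D x \<in> G}" by (rule eventually_nhds_in_open)
    then show "\<forall>\<^sub>F u' in nhds u. \<forall>v\<in>B. norm (D u' v - D u v) < e"
      by (rule eventually_mono) (force simp: G_def)
  qed
next
  assume R: ?R
  have "open {x \<in> U. D x \<in> G}" if G: "beta_open G" for G
    unfolding open_subopen[of "{x \<in> U. D x \<in> G}"]
  proof
    fix u assume "u \<in> {x \<in> U. D x \<in> G}"
    then have u: "u \<in> U" "D u \<in> G" by auto
    obtain B N where BN: "tvs_bounded B" "open N" "0 \<in> N"
      "{A' \<in> cont_linear_maps. (\<lambda>v. A' v - D u v) \<in> beta_nhd B N} \<subseteq> G"
      using G u(2) unfolding beta_open_def by blast
    obtain e where e: "e > 0" "ball 0 e \<subseteq> N" using BN(2,3) by (meson openE)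
    have "\<forall>\<^sub>F u' in nhds u. \<forall>v\<in>B. norm (D u' v - D u v) < e" using R u(1) BN(1) e(1) by blast
    then have "\<forall>\<^sub>F u' in nhds u. u' \<in> {x \<in> U. D x \<in> G}"
      using eventually_nhds_in_open[OF U u(1)]
    proof eventually_elim
      case (elim u')
      then have "(\<lambda>v. D u' v - D u v) \<in> beta_nhd B N"
        using e(2) u(1) D by (auto simp: beta_nhd_def intro: cont_linear_maps_diff)
      then show ?case using BN(4) D elim by blast
    qed
    then show "\<exists>T. open T \<and> u \<in> T \<and> T \<subseteq> {x \<in> U. D x \<in> G}"
      unfolding eventually_nhds by blast
  qed
  then show ?L
    using U D by (auto simp: continuous_map openin_beta_topology topspace_beta_topology
        openin_open_eq)
qed

section \<open>Maps of class C1F with values in normed spaces\<close>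

lemma C1F_on_normedD:
  fixes f :: "'a::real_tvs \<Rightarrow> 'b::real_normed_vector"
  assumes "C1F_on U f"
  shows "open U" "continuous_on U f"
    and "u \<in> U \<Longrightarrow> has_dir_deriv f u v (dir_deriv f u v)"
    and "u \<in> U \<Longrightarrow> linear (dir_deriv f u)"
    and "u \<in> U \<Longrightarrow> continuous_on UNIV (dir_deriv f u)"
    and "u \<in> U \<Longrightarrow> tvs_bounded B \<Longrightarrow> e > 0 \<Longrightarrow>
      \<forall>\<^sub>F u' in nhds u. \<forall>v\<in>B. norm (dir_deriv f u' v - dir_deriv f u v) < e"
proof -
  have C: "open U" "continuous_map (top_of_set U) beta_topology (dir_deriv f)"
    "\<And>u. u \<in> U \<Longrightarrow> dir_deriv f u \<in> cont_linear_maps"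
    using assms by (auto simp: C1F_on_def cont_linear_maps_def)
  show "open U" "continuous_on U f"
    and "u \<in> U \<Longrightarrow> linear (dir_deriv f u)"
    and "u \<in> U \<Longrightarrow> continuous_on UNIV (dir_deriv f u)"
    using assms by (auto simp: C1F_on_def)
  show "has_dir_deriv f u v (dir_deriv f u v)" if "u \<in> U"
    using assms that dir_deriv_eq unfolding C1F_on_def by metis
  show "u \<in> U \<Longrightarrow> tvs_bounded B \<Longrightarrow> e > 0 \<Longrightarrow>
      \<forall>\<^sub>F u' in nhds u. \<forall>v\<in>B. norm (dir_deriv f u' v - dir_deriv f u v) < e"
    using continuous_map_beta_iff[THEN iffD1, OF C(1,3,2)] by blast
qed

text \<open>Limits are unique, so a candidate \<open>D\<close> agrees with
  \<open>dir_deriv f\<close> on \<open>U\<close>, and linearity and \<beta>-continuity can be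
  checked on the candidate.\<close>

lemma C1F_on_normedI:
  fixes f :: "'a::real_tvs \<Rightarrow> 'b::real_normed_vector"
  assumes U: "open U" and cont: "continuous_on U f"
    and der: "\<And>u v. u \<in> U \<Longrightarrow> has_dir_deriv f u v (D u v)"
    and D: "\<And>u. u \<in> U \<Longrightarrow> linear (D u)" "\<And>u. u \<in> U \<Longrightarrow> continuous_on UNIV (D u)"
    and beta: "\<And>u B e. u \<in> U \<Longrightarrow> tvs_bounded B \<Longrightarrow> e > 0 \<Longrightarrow>
      \<forall>\<^sub>F u' in nhds u. \<forall>v\<in>B. norm (D u' v - D u v) < e"
  shows "C1F_on U f"
proof -
  have eq: "dir_deriv f u = D u" if "u \<in> U" for u
    using der that dir_deriv_eq by blast
  have "continuous_map (top_of_set U) beta_topology D"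
    using D beta by (subst continuous_map_beta_iff[OF U]) (auto simp: cont_linear_maps_def)
  then have "continuous_map (top_of_set U) beta_topology (dir_deriv f)"
    by (rule continuous_map_eq) (simp add: eq)
  then show ?thesis
    unfolding C1F_on_def using U cont der D by (auto simp: eq)
qed

text \<open>Serves to normalise the partial derivative by taking the inverse of that derivative for
  \<open>L\<close>. A bounded linear map commutes with the limit of difference quotients, and its
  bound \<open>K\<close> turns \<beta>-closeness \<open>e / K\<close> into \<open>e\<close>.\<close>

lemma C1F_on_bounded_linear_compose:
  fixes f :: "'a::real_tvs \<Rightarrow> 'b::real_normed_vector" and L :: "'b \<Rightarrow> 'c::real_normed_vector"
  assumes f: "C1F_on U f" and L: "bounded_linear L"
  shows "C1F_on U (\<lambda>u. L (f u))" (is ?C)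
    and "u \<in> U \<Longrightarrow> dir_deriv (\<lambda>u. L (f u)) u v = L (dir_deriv f u v)"
proof -
  interpret L: bounded_linear L by fact
  note fD = C1F_on_normedD[OF f]
  have der: "has_dir_deriv (\<lambda>u. L (f u)) u v (L (dir_deriv f u v))" if "u \<in> U" for u v
    using L.tendsto[OF fD(3)[OF that, of v, unfolded has_dir_deriv_def]]
    by (simp add: has_dir_deriv_def L.scaleR L.diff)
  then show "u \<in> U \<Longrightarrow> dir_deriv (\<lambda>u. L (f u)) u v = L (dir_deriv f u v)"
    by (rule dir_deriv_eq)
  obtain K where K: "K > 0" "\<And>x. norm (L x) \<le> norm x * K" using L.pos_bounded by blast
  show ?C
  proof (rule C1F_on_normedI[OF fD(1)])
    show "continuous_on U (\<lambda>u. L (f u))" by (rule L.continuous_on[OF fD(2)])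
    fix u assume u: "u \<in> U"
    show "has_dir_deriv (\<lambda>u. L (f u)) u v (L (dir_deriv f u v))" for v by (rule der[OF u])
    show "linear (\<lambda>v. L (dir_deriv f u v))"
      using linear_compose[OF fD(4)[OF u] L.linear_axioms] by (simp add: o_def)
    show "continuous_on UNIV (\<lambda>v. L (dir_deriv f u v))" by (rule L.continuous_on[OF fD(5)[OF u]])
    fix B :: "'a set" and e :: real assume B: "tvs_bounded B" and e: "e > 0"
    have "e / K > 0" using e K(1) by simp
    from fD(6)[OF u B this]
    show "\<forall>\<^sub>F u' in nhds u. \<forall>v\<in>B. norm (L (dir_deriv f u' v) - L (dir_deriv f u v)) < e"
    proof eventually_elim
      case (elim u')
      show ?case
      proof
        fix v assume "v \<in> B"
        with elim have "norm (dir_deriv f u' v - dir_deriv f u v) * K < e"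
          using K(1) by (simp add: field_simps)
        then show "norm (L (dir_deriv f u' v) - L (dir_deriv f u v)) < e"
          using K(2)[of "dir_deriv f u' v - dir_deriv f u v"] by (simp add: L.diff)
      qed
    qed
  qed
qed

section \<open>Estimates in the Banach direction and differentiation of an implicit function\<close>

lemma linear_Pair_zero: "linear (\<lambda>x. (0::'a::real_vector, x::'b::real_vector))"
  by (auto intro!: linearI)

text \<open>The unit ball embedded by \<open>x \<mapsto> (0, x)\<close> is bounded in the product,
  so \<beta>-continuity controls the derivative on it, and homogeneity extends the control to every
  \<open>y\<close>.\<close>

lemma C1F_on_partial2_uniform:
  fixes f :: "'t::real_tvs \<times> 'b::real_normed_vector \<Rightarrow> 'e::real_normed_vector"
  assumes f: "C1F_on U f" and u: "u \<in> U" and e: "e > 0"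
  shows "\<forall>\<^sub>F u' in nhds u. u' \<in> U \<and>
    (\<forall>y. norm (dir_deriv f u' (0, y) - dir_deriv f u (0, y)) \<le> e * norm y)"
proof -
  note fD = C1F_on_normedD[OF f]
  have "tvs_bounded ((\<lambda>x. (0::'t, x::'b)) ` cball 0 1)"
    by (intro tvs_bounded_image linear_Pair_zero tvs_bounded_cball continuous_intros)
  from fD(6)[OF u this e] eventually_nhds_in_open[OF fD(1) u]
  show ?thesis
  proof eventually_elim
    case (elim u')
    have "norm (dir_deriv f u' (0, y) - dir_deriv f u (0, y)) \<le> e * norm y" for y
    proof (cases "y = 0")
      case True
      then show ?thesis
        using fD(4)[OF u] fD(4)[OF elim(2)] by (simp add: linear_0 flip: zero_prod_def)
    next
      case False
      have sc: "dir_deriv f w (0, y /\<^sub>R norm y) = dir_deriv f w (0, y) /\<^sub>R norm y" if "w \<in> U" for w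
        using linear_scale[OF fD(4)[OF that], of "inverse (norm y)" "(0, y)"] by simp
      have "y /\<^sub>R norm y \<in> cball 0 1" using False by simp
      with elim(1) have "norm (dir_deriv f u' (0, y /\<^sub>R norm y) - dir_deriv f u (0, y /\<^sub>R norm y)) < e"
        by blast
      then have "norm (dir_deriv f u' (0, y) - dir_deriv f u (0, y)) / norm y < e"
        using False by (simp add: sc[OF u] sc[OF elim(2)] divide_inverse mult.commute
            flip: scaleR_diff_right)
      then show ?thesis using False by (simp add: pos_divide_less_eq less_imp_le)
    qed
    then show ?case using elim by blast
  qed
qed

text \<open>In the second factor the neighbourhood is taken to be a ball: in a normed space balls
  are convex, so the segments of the mean value estimate stay inside. In the first factor only a
  filter is available.\<close>

lemma eventually_nhds_Pair_ball:
  fixes x :: "'b::metric_space"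
  assumes "eventually P (nhds (t, x))"
  obtains r where "r > 0" "\<forall>\<^sub>F s in nhds t. \<forall>y\<in>ball x r. P (s, y)"
proof -
  obtain Q R where Q: "eventually Q (nhds t)" and R: "eventually R (nhds x)"
    and P: "\<And>s y. Q s \<Longrightarrow> R y \<Longrightarrow> P (s, y)"
    using assms unfolding nhds_prod eventually_prod_filter by auto
  obtain r where r: "r > 0" "\<And>y. dist y x < r \<Longrightarrow> R y"
    using R unfolding eventually_nhds_metric by blast
  have "\<forall>\<^sub>F s in nhds t. \<forall>y\<in>ball x r. P (s, y)"
    using Q
  proof (rule eventually_mono)
    fix s assume Qs: "Q s"
    show "\<forall>y\<in>ball x r. P (s, y)"
    proof
      fix y assume "y \<in> ball x r"
      then have "dist y x < r" by (simp add: dist_commute)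
      then show "P (s, y)" by (rule P[OF Qs r(2)])
    qed
  qed
  with r(1) show thesis by (rule that)
qed

lemma mean_value_partial2:
  fixes f :: "'t::real_tvs \<times> 'b::real_normed_vector \<Rightarrow> 'e::real_normed_vector"
  assumes f: "C1F_on U f"
    and U: "\<And>z. z \<in> closed_segment x y \<Longrightarrow> (t, z) \<in> U"
    and bd: "\<And>z. z \<in> closed_segment x y \<Longrightarrow> norm (dir_deriv f (t, z) (0, y - x) - l) \<le> c"
  shows "norm (f (t, y) - f (t, x) - l) \<le> c"
proof -
  have seg: "x + s *\<^sub>R (y - x) \<in> closed_segment x y" if "s \<in> {0..1}" for s
    using that by (auto simp: in_segment algebra_simps intro!: exI[of _ s])
  have "norm (f ((t, x) + (0, y - x)) - f (t, x) - l) \<le> c"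
    by (rule mean_value_estimate[where D = "\<lambda>s. dir_deriv f (t, x + s *\<^sub>R (y - x)) (0, y - x)"])
      (use C1F_on_normedD(3)[OF f U] bd seg in auto)
  then show ?thesis by simp
qed

text \<open>The equation \<open>F (s, g s) = 0\<close> is expanded around \<open>(s, g t)\<close> in
  the Banach direction only. Along \<open>s = t + h *\<^sub>R v\<close> this gives
  \<open>d + D (0, q) \<approx> 0\<close>, with \<open>d\<close> tending to
  \<open>D (v, 0) = - D (0, w)\<close>; the lower bound on \<open>D (0, y)\<close> then forces
  \<open>q\<close> to tend to \<open>w\<close>.\<close>

lemma implicit_has_dir_deriv:
  fixes F :: "'t::real_tvs \<times> 'b::real_normed_vector \<Rightarrow> 'e::real_normed_vector"
  assumes F: "C1F_on U F" and U: "(t, g t) \<in> U"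
    and zero: "F (t, g t) = 0" "\<forall>\<^sub>F s in nhds t. F (s, g s) = 0"
    and cont: "(g \<longlongrightarrow> g t) (nhds t)"
    and growth: "\<forall>\<^sub>F s in nhds t. norm (g s - g t) \<le> C * norm (F (s, g t))"
    and lower: "\<And>y. norm y \<le> C * norm (dir_deriv F (t, g t) (0, y))"
    and w: "dir_deriv F (t, g t) (v, w) = 0"
    and C: "C > 0"
  shows "has_dir_deriv g t v w"
proof -
  note FD = C1F_on_normedD[OF F]
  note lin = FD(4)[OF U]
  define D where "D = dir_deriv F (t, g t)"
  define p where "p = D (v, 0)"
  have Dw: "D (0, w) = - p"
    using w linear_add[OF lin, of "(v, 0)" "(0, w)"]
    by (simp add: D_def p_def eq_neg_iff_add_eq_0 add.commute)
  \<comment> \<open>Since \<open>F (t, g t) = 0\<close>, \<open>d\<close> is the difference quotient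
    of \<open>F\<close> in the direction \<open>(v, 0)\<close>, so it tends to
    \<open>p\<close>.\<close>
  define d where "d h = (1 / h) *\<^sub>R F (t + h *\<^sub>R v, g t)" for h :: real
  define q where "q h = (1 / h) *\<^sub>R (g (t + h *\<^sub>R v) - g t)" for h :: real
  have nz: "\<forall>\<^sub>F h in at 0. h \<noteq> (0::real)" by (simp add: eventually_at_filter)
  have d: "(d \<longlongrightarrow> p) (at 0)"
    using FD(3)[OF U, of "(v, 0)"] zero by (simp add: has_dir_deriv_def d_def[abs_def] D_def p_def)
  \<comment> \<open>As \<open>d\<close> converges, this bounds \<open>q\<close> near 0 and so
    disposes of the term \<open>e * norm (q h)\<close> in \<open>qw\<close>.\<close>
  have q_le: "\<forall>\<^sub>F h in at 0. norm (q h) \<le> C * norm (d h)"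
    using eventually_line[OF growth, of v] nz
    by eventually_elim (simp add: q_def d_def divide_right_mono)
  have qw: "\<forall>\<^sub>F h in at 0. norm (q h - w) \<le> C * (norm (d h - p) + e * norm (q h))" if e: "e > 0" for e
  proof -
    obtain r where r: "r > 0" and ev: "\<forall>\<^sub>F s in nhds t. \<forall>z\<in>ball (g t) r. (s, z) \<in> U \<and>
        (\<forall>y. norm (dir_deriv F (s, z) (0, y) - D (0, y)) \<le> e * norm y)"
      using C1F_on_partial2_uniform[OF F U e, folded D_def] by (rule eventually_nhds_Pair_ball)
    have "\<forall>\<^sub>F s in nhds t. g s \<in> ball (g t) r"
      using tendstoD[OF cont r] by (simp add: dist_commute)
    with ev zero(2) have "\<forall>\<^sub>F s in nhds t.
        norm (F (s, g t) + D (0, g s - g t)) \<le> e * norm (g s - g t)"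
    proof eventually_elim
      case (elim s)
      have "closed_segment (g t) (g s) \<subseteq> ball (g t) r"
        using elim(3) r by (intro closed_segment_subset) auto
      then have "norm (F (s, g s) - F (s, g t) - D (0, g s - g t)) \<le> e * norm (g s - g t)"
        using elim(1) by (intro mean_value_partial2[OF F]) auto
      then show ?case using elim(2) by (simp add: norm_minus_commute[of "- _"] add.commute)
    qed
    from eventually_line[OF this, of v] nz show ?thesis
    proof eventually_elim
      case (elim h)
      have "D (0, q h) = (1 / h) *\<^sub>R D (0, g (t + h *\<^sub>R v) - g t)"
        using linear_scale[OF lin, of "1 / h" "(0, g (t + h *\<^sub>R v) - g t)"]
        by (simp add: D_def q_def)
      then have "d h + D (0, q h) = (1 / h) *\<^sub>R (F (t + h *\<^sub>R v, g t) + D (0, g (t + h *\<^sub>R v) - g t))"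
        by (simp add: d_def scaleR_add_right)
      then have *: "norm (d h + D (0, q h)) \<le> e * norm (q h)"
        using elim by (simp add: q_def divide_right_mono)
      have "D (0, q h - w) = (d h + D (0, q h)) - (d h - p)"
        using linear_diff[OF lin, of "(0, q h)" "(0, w)"] Dw by (simp add: D_def)
      then have "norm (D (0, q h - w)) \<le> norm (d h - p) + e * norm (q h)"
        using norm_triangle_ineq4[of "d h + D (0, q h)" "d h - p"] * by simp
      then show ?case
        using lower[of "q h - w"] C unfolding D_def[symmetric]
        by (meson mult_left_mono less_imp_le order_trans)
    qed
  qed
  have "(q \<longlongrightarrow> w) (at 0)"
  proof (rule tendstoI)
    fix \<eta> :: real assume \<eta>: "\<eta> > 0"
    \<comment> \<open>Chosen so that \<open>e * (C * (norm p + 1)) = \<eta> / (2 * C)\<close>. Here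
      \<open>C * (norm p + 1)\<close> bounds \<open>norm (q h)\<close> once \<open>d h\<close> is
      within 1 of \<open>p\<close>; the summand 1 also keeps the denominator positive.\<close>
    define e where "e = \<eta> / (2 * C * C * (norm p + 1))"
    have n1: "norm p + 1 > 0" using norm_ge_zero[of p] by linarith
    have e: "e > 0" using \<eta> C n1 by (simp add: e_def)
    have "\<eta> / (2 * C) > 0" using \<eta> C by simp
    from tendstoD[OF d this] tendstoD[OF d zero_less_one] q_le qw[OF e]
    show "\<forall>\<^sub>F h in at 0. dist (q h) w < \<eta>"
    proof eventually_elim
      case (elim h)
      have "norm (d h) \<le> norm p + 1"
        using elim(2) norm_triangle_ineq2[of "d h" p] by (simp add: dist_norm)
      then have "norm (q h) \<le> C * (norm p + 1)"
        using elim(3) C by (meson mult_left_mono less_imp_le order_trans)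
      then have "e * norm (q h) \<le> e * (C * (norm p + 1))" using e by simp
      also have "\<dots> = \<eta> / (2 * C)" using C n1 by (simp add: e_def)
      finally have "norm (d h - p) + e * norm (q h) < \<eta> / (2 * C) + \<eta> / (2 * C)"
        using elim(1) by (simp add: dist_norm)
      then have "norm (d h - p) + e * norm (q h) < \<eta> / C" by simp
      then have "C * (norm (d h - p) + e * norm (q h)) < \<eta>"
        using C by (simp add: field_simps)
      then show ?case using elim(4) by (simp add: dist_norm)
    qed
  qed
  then show ?thesis by (simp add: has_dir_deriv_def q_def[abs_def])
qed

section \<open>Perturbations of the identity on a Banach space\<close>

lemma near_identity_lower_bound:
  fixes Q :: "'b::real_normed_vector \<Rightarrow> 'b"
  assumes "norm (Q y - y) \<le> 1/2 * norm y"
  shows "norm y \<le> 2 * norm (Q y)"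
  using assms norm_triangle_ineq2[of y "Q y"] by (simp add: norm_minus_commute)

text \<open>A solution is a fixed point of \<open>y \<mapsto> y - Q y + z\<close>, which by
  linearity contracts with constant \<open>1/2\<close>.\<close>

lemma near_identity_surj:
  fixes Q :: "'b::banach \<Rightarrow> 'b"
  assumes "linear Q" "\<And>y. norm (Q y - y) \<le> 1/2 * norm y"
  shows "\<exists>y. Q y = z"
proof -
  have "dist (x - Q x + z) (y - Q y + z) \<le> 1/2 * dist x y" for x y
    using assms(2)[of "x - y"]
    by (simp add: dist_norm linear_diff[OF assms(1)] norm_minus_commute algebra_simps)
  then have "\<exists>!y. y - Q y + z = y"
    by (intro banach_fix_type[of "1/2"]) auto
  then show ?thesis by (auto simp: algebra_simps)
qed

text \<open>Zeros of \<open>G\<close> are the fixed points of \<open>x \<mapsto> x - G x\<close>, a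
  contraction with constant \<open>1/2\<close>. It maps the closed ball of radius \<open>r/2\<close>
  into itself: the centre moves by less than \<open>r/4\<close>, and the contraction adds at most
  \<open>r/4\<close>. That ball is complete and lies in the open ball of radius
  \<open>r\<close>.\<close>

lemma near_identity_zero:
  fixes G :: "'b::banach \<Rightarrow> 'b"
  assumes r: "r > 0"
    and G: "\<And>x y. x \<in> ball x0 r \<Longrightarrow> y \<in> ball x0 r \<Longrightarrow> norm (G y - G x - (y - x)) \<le> 1/2 * norm (y - x)"
    and G0: "norm (G x0) < r / 4"
  shows "\<exists>x\<in>ball x0 r. G x = 0"
proof -
  have "\<exists>!x\<in>cball x0 (r/2). x - G x = x"
  proof (rule Banach_fix)
    show "complete (cball x0 (r/2))" by (simp add: complete_eq_closed)
    show "cball x0 (r/2) \<noteq> {}" using r by simp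
    have sub: "x \<in> ball x0 r" if "x \<in> cball x0 (r/2)" for x using that r by simp
    show "dist (x - G x) (y - G y) \<le> 1/2 * dist x y"
      if "x \<in> cball x0 (r/2)" "y \<in> cball x0 (r/2)" for x y
    proof -
      have "(x - G x) - (y - G y) = G y - G x - (y - x)" by simp
      then show ?thesis using G[OF sub sub, OF that] by (simp only: dist_norm norm_minus_commute[of x y])
    qed
    show "(\<lambda>x. x - G x) ` cball x0 (r/2) \<subseteq> cball x0 (r/2)"
    proof (rule image_subsetI)
      fix x assume x: "x \<in> cball x0 (r/2)"
      have "x0 - (x - G x) = (G x - G x0 - (x - x0)) + G x0" by simp
      then have "norm (x0 - (x - G x)) \<le> norm (G x - G x0 - (x - x0)) + norm (G x0)"
        by (metis norm_triangle_ineq)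
      also have "\<dots> \<le> 1/2 * norm (x - x0) + r / 4"
        using G[of x0 x] sub[OF x] r G0 by (intro add_mono) auto
      also have "\<dots> \<le> r / 2" using x by (simp add: dist_norm norm_minus_commute)
      finally show "x - G x \<in> cball x0 (r/2)" by (simp add: dist_norm)
    qed
  qed auto
  then obtain x where "x \<in> cball x0 (r/2)" "G x = 0" by auto
  then show ?thesis using r by (intro bexI[of _ x]) auto
qed

section \<open>The implicit function theorem with identity partial derivative\<close>

lemma implicit_function_near_identity:
  fixes F :: "'t::real_tvs \<times> 'b::banach \<Rightarrow> 'b"
  assumes F: "C1F_on U F" and u0: "(t0, x0) \<in> U" and F0: "F (t0, x0) = 0"
    and D2: "\<And>y. dir_deriv F (t0, x0) (0, y) = y"
  shows "\<exists>V W (g :: 't \<Rightarrow> 'b).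
    open V \<and> t0 \<in> V \<and> open W \<and> x0 \<in> W \<and> V \<times> W \<subseteq> U \<and>
    C1F_on V g \<and> g ` V \<subseteq> W \<and> g t0 = x0 \<and> (\<forall>t\<in>V. \<forall>x\<in>W. F (t, x) = 0 \<longleftrightarrow> x = g t)"
proof -
  note FD = C1F_on_normedD[OF F]
  have cont: "((\<lambda>s. F (s, x)) \<longlongrightarrow> F (t, x)) (nhds t)" if "(t, x) \<in> U" for t x
  proof -
    have "(F \<longlongrightarrow> F (t, x)) (nhds (t, x))"
      by (rule tendsto_at_iff_tendsto_nhds[THEN iffD1])
        (metis FD(1,2) that continuous_on_def at_within_open)
    moreover have "((\<lambda>s. (s, x)) \<longlongrightarrow> (t, x)) (nhds t)"
      by (intro tendsto_Pair filterlim_ident tendsto_const)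
    ultimately show ?thesis by (rule filterlim_compose)
  qed
  obtain r where r: "r > 0" and ev: "\<forall>\<^sub>F s in nhds t0. \<forall>z\<in>ball x0 r. (s, z) \<in> U \<and>
      (\<forall>y. norm (dir_deriv F (s, z) (0, y) - dir_deriv F (t0, x0) (0, y)) \<le> 1/2 * norm y)"
    using C1F_on_partial2_uniform[OF F u0, of "1/2"] by (auto elim: eventually_nhds_Pair_ball)
  have "\<forall>\<^sub>F s in nhds t0. norm (F (s, x0)) < r / 4"
    using tendstoD[OF cont[OF u0], of "r/4"] r F0 by simp
  with ev have "\<forall>\<^sub>F s in nhds t0. (\<forall>z\<in>ball x0 r. (s, z) \<in> U \<and>
      (\<forall>y. norm (dir_deriv F (s, z) (0, y) - y) \<le> 1/2 * norm y)) \<and> norm (F (s, x0)) < r / 4"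
    unfolding D2 by (rule eventually_conj)
  \<comment> \<open>\<open>VD\<close> supplies the contraction constant \<open>1/2\<close> on the
    ball, and \<open>V0\<close> the bound on the displacement of the centre required by
    \<open>near_identity_zero\<close>.\<close>
  then obtain V where V: "open V" "t0 \<in> V"
    and VU: "\<And>t z. t \<in> V \<Longrightarrow> z \<in> ball x0 r \<Longrightarrow> (t, z) \<in> U"
    and VD: "\<And>t z y. t \<in> V \<Longrightarrow> z \<in> ball x0 r \<Longrightarrow>
      norm (dir_deriv F (t, z) (0, y) - y) \<le> 1/2 * norm y"
    and V0: "\<And>t. t \<in> V \<Longrightarrow> norm (F (t, x0)) < r / 4"
    unfolding eventually_nhds by blast
  have est: "norm (F (t, y) - F (t, x) - (y - x)) \<le> 1/2 * norm (y - x)"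
    if "t \<in> V" "x \<in> ball x0 r" "y \<in> ball x0 r" for t x y
  proof -
    have "closed_segment x y \<subseteq> ball x0 r" using that by (intro closed_segment_subset) auto
    then show ?thesis using VU VD that(1) by (intro mean_value_partial2[OF F]) auto
  qed
  \<comment> \<open>Gives uniqueness of the zero for each \<open>t\<close>, and also the growth
    bound from which continuity of \<open>g\<close> follows.\<close>
  have inj: "norm (y - x) \<le> 2 * norm (F (t, y) - F (t, x))"
    if "t \<in> V" "x \<in> ball x0 r" "y \<in> ball x0 r" for t x y
    using est[OF that] norm_triangle_ineq2[of "y - x" "F (t, y) - F (t, x)"]
    by (simp add: norm_minus_commute)
  have "\<exists>x\<in>ball x0 r. F (t, x) = 0" if "t \<in> V" for t
    by (rule near_identity_zero[OF r est V0]) (use that in auto)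
  then obtain g where g: "\<And>t. t \<in> V \<Longrightarrow> g t \<in> ball x0 r" "\<And>t. t \<in> V \<Longrightarrow> F (t, g t) = 0"
    by metis
  have iff: "F (t, x) = 0 \<longleftrightarrow> x = g t" if "t \<in> V" "x \<in> ball x0 r" for t x
    using inj[OF that(1) g(1)[OF that(1)] that(2)] g(2) that by auto
  have gU: "(t, g t) \<in> U" if "t \<in> V" for t using VU g(1) that by blast
  have evV: "\<forall>\<^sub>F s in nhds t. s \<in> V" if "t \<in> V" for t
    using V(1) that by (rule eventually_nhds_in_open)
  \<comment> \<open>Comparing \<open>g s\<close> and \<open>g t\<close> at the same parameter
    \<open>s\<close>, where \<open>F (s, g s) = 0\<close>, leaves only \<open>F (s, g t)\<close>,
    which tends to \<open>F (t, g t) = 0\<close> as \<open>s\<close> tends to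
    \<open>t\<close>.\<close>
  have growth: "\<forall>\<^sub>F s in nhds t. norm (g s - g t) \<le> 2 * norm (F (s, g t))" if t: "t \<in> V" for t
    using evV[OF t]
  proof eventually_elim
    case (elim s)
    then show ?case using inj[of s "g t" "g s"] g t by auto
  qed
  have gcont: "(g \<longlongrightarrow> g t) (nhds t)" if t: "t \<in> V" for t
  proof -
    have "((\<lambda>s. 2 * norm (F (s, g t))) \<longlongrightarrow> 2 * norm (F (t, g t))) (nhds t)"
      by (intro tendsto_intros cont gU t)
    then have "((\<lambda>s. g s - g t) \<longlongrightarrow> 0) (nhds t)"
      using growth[OF t] g(2)[OF t] by (intro Lim_null_comparison[where f = "\<lambda>s. g s - g t"]) auto
    then show ?thesis by (simp add: LIM_zero_iff)
  qed
  define D where "D t = dir_deriv F (t, g t)" for t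
  have lin: "linear (D t)" and Dcont: "continuous_on UNIV (D t)" if "t \<in> V" for t
    using FD(4,5) gU[OF that] by (auto simp: D_def)
  have lower: "norm y \<le> 2 * norm (D t (0, y))" if "t \<in> V" for t y
    using VD[OF that g(1)[OF that]] by (intro near_identity_lower_bound) (simp add: D_def)
  have "\<exists>w. D t (v, w) = 0" if t: "t \<in> V" for t v
  proof -
    have "linear (\<lambda>y. D t (0, y))"
      using linear_compose[OF linear_Pair_zero lin[OF t]] by (simp add: o_def)
    then obtain y where "D t (0, y) = - D t (v, 0)"
      using near_identity_surj[of "\<lambda>y. D t (0, y)"] VD[OF t g(1)[OF t]] unfolding D_def by blast
    then have "D t (v, y) = 0" using linear_add[OF lin[OF t], of "(v, 0)" "(0, y)"] by simp
    then show ?thesis by blast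
  qed
  then obtain w where w: "\<And>t v. t \<in> V \<Longrightarrow> D t (v, w t v) = 0" by metis
  \<comment> \<open>The defect of \<open>y\<close> in the equation for \<open>w t v\<close> controls
    the distance to \<open>w t v\<close>. Zero defect gives linearity of the chosen
    \<open>w t\<close>, defect tending to 0 gives its continuity, and uniformly small defect on
    bounded sets gives \<beta>-continuity.\<close>
  have close: "norm (w t v - y) \<le> 2 * norm (D t (v, y))" if t: "t \<in> V" for t v y
    using lower[OF t, of "w t v - y"] linear_diff[OF lin[OF t], of "(v, w t v)" "(v, y)"] w[OF t, of v]
    by simp
  have wlin: "linear (w t)" if t: "t \<in> V" for t
  proof (rule linearI)
    fix a b
    show "w t (a + b) = w t a + w t b"
      using close[OF t, of "a + b" "w t a + w t b"]
        linear_add[OF lin[OF t], of "(a, w t a)" "(b, w t b)"] w[OF t] by simp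
  next
    fix c a
    show "w t (c *\<^sub>R a) = c *\<^sub>R w t a"
      using close[OF t, of "c *\<^sub>R a" "c *\<^sub>R w t a"]
        linear_scale[OF lin[OF t], of c "(a, w t a)"] w[OF t] by simp
  qed
  have wcont: "continuous_on UNIV (w t)" if t: "t \<in> V" for t
    unfolding continuous_on_def
  proof
    fix v
    \<comment> \<open>With the second component frozen at \<open>w t v\<close>, the defect
      \<open>D t (v', w t v)\<close> tends to \<open>D t (v, w t v) = 0\<close>.\<close>
    have "((\<lambda>v'. (v', w t v)) \<longlongrightarrow> (v, w t v)) (at v)" by (intro tendsto_intros)
    then have "((\<lambda>v'. D t (v', w t v)) \<longlongrightarrow> D t (v, w t v)) (at v)"
      using continuous_on_tendsto_compose[OF Dcont[OF t]] by auto
    then have "((\<lambda>v'. 2 * norm (D t (v', w t v))) \<longlongrightarrow> 2 * norm (D t (v, w t v))) (at v)"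
      by (intro tendsto_intros)
    then have "((\<lambda>v'. w t v' - w t v) \<longlongrightarrow> 0) (at v)"
      using close[OF t] w[OF t]
      by (intro Lim_null_comparison[where f = "\<lambda>v'. w t v' - w t v"]) auto
    then show "(w t \<longlongrightarrow> w t v) (at v)" by (simp add: LIM_zero_iff)
  qed
  have "C1F_on V g"
  proof (rule C1F_on_normedI[OF V(1)])
    show "continuous_on V g"
      unfolding continuous_on_def
      using gcont filterlim_mono[OF _ order_refl at_within_le_nhds] by blast
    fix t assume t: "t \<in> V"
    show "has_dir_deriv g t v (w t v)" for v
      using evV[OF t] g(2)
      by (intro implicit_has_dir_deriv[OF F gU[OF t] g(2)[OF t] _ gcont[OF t] growth[OF t]])
        (use lower[OF t] w[OF t] in \<open>auto simp: D_def elim!: eventually_mono\<close>)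
    show "linear (w t)" "continuous_on UNIV (w t)" using wlin wcont t by auto
    fix B :: "'t set" and e :: real assume B: "tvs_bounded B" and e: "e > 0"
    \<comment> \<open>The bounded set of all \<open>(v, w t v)\<close> lies in the kernel of \<open>D t\<close>, and on it \<open>D s\<close> controls
      the distance between \<open>w s\<close> and \<open>w t\<close>.\<close>
    have "linear (\<lambda>v. (v, w t v))"
      using linear_add[OF wlin[OF t]] linear_scale[OF wlin[OF t]] by (intro linearI) auto
    moreover have "continuous_on UNIV (\<lambda>v. (v, w t v))"
      by (intro continuous_on_Pair continuous_on_id wcont t)
    ultimately have "tvs_bounded ((\<lambda>v. (v, w t v)) ` B)" using B by (rule tvs_bounded_image)
    \<comment> \<open>The tolerance \<open>e / 2\<close> offsets the factor 2 in
      \<open>close\<close>.\<close>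
    from FD(6)[OF gU[OF t] this, of "e / 2"] e
    have "\<forall>\<^sub>F u in nhds (t, g t). \<forall>v\<in>B. norm (dir_deriv F u (v, w t v)) < e / 2"
      using w[OF t] by (simp add: D_def)
    moreover have "((\<lambda>s. (s, g s)) \<longlongrightarrow> (t, g t)) (nhds t)"
      by (intro tendsto_Pair filterlim_ident gcont t)
    ultimately have "\<forall>\<^sub>F s in nhds t. \<forall>v\<in>B. norm (D s (v, w t v)) < e / 2"
      unfolding D_def by (auto simp: filterlim_iff)
    with evV[OF t] show "\<forall>\<^sub>F s in nhds t. \<forall>v\<in>B. norm (w s v - w t v) < e"
    proof eventually_elim
      case (elim s)
      show ?case
      proof
        fix v assume "v \<in> B"
        then have "norm (D s (v, w t v)) < e / 2" using elim by blast
        then show "norm (w s v - w t v) < e" using close[OF \<open>s \<in> V\<close>, of v "w t v"] by simp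
      qed
    qed
  qed
  moreover have "g t0 = x0" using iff[OF V(2), of x0] r F0 by simp
  ultimately show ?thesis
    using V r g(1) VU iff by (intro exI[of _ V] exI[of _ "ball x0 r"] exI[of _ g]) auto
qed

section \<open>Reduction of the general case to identity partial derivative\<close>

theorem theorem6p1:
  fixes U :: "('t::frechet_space \<times> 'b::banach) set"
    and f :: "'t \<times> 'b \<Rightarrow> 'e::banach"
    and t0 :: 't and x0 :: 'b
  assumes "open U"
    and "C1F_on U f"
    and "(t0, x0) \<in> U"
    and "f (t0, x0) = 0"
    and "bij (partial_deriv2 f t0 x0)"
  shows "\<exists>V W (g :: 't \<Rightarrow> 'b).
    open V \<and> t0 \<in> V \<and> open W \<and> x0 \<in> W \<and> V \<times> W \<subseteq> U \<and>
    C1F_on V g \<and> g ` V \<subseteq> W \<and> g t0 = x0 \<and>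
    {(t, x). (t, x) \<in> V \<times> W \<and> f (t, x) = 0} = {(t, x). (t, x) \<in> V \<times> W \<and> x = g t}"
proof -
  define A where "A = partial_deriv2 f t0 x0"
  \<comment> \<open>The two difference quotients coincide because the first component of
    \<open>(t0, x0) + h *\<^sub>R (0, y)\<close> is \<open>t0\<close>.\<close>
  have A_eq: "A = (\<lambda>y. dir_deriv f (t0, x0) (0, y))"
    by (simp add: A_def partial_deriv2_def[abs_def] dir_deriv_def)
  note fD = C1F_on_normedD[OF assms(2)]
  have "linear A"
    using linear_compose[OF linear_Pair_zero fD(4)[OF assms(3)]] by (simp add: A_eq o_def)
  moreover have "continuous_on UNIV A"
    unfolding A_eq
    by (rule continuous_on_compose2[OF fD(5)[OF assms(3)]]) (auto intro!: continuous_intros)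
  ultimately have "bounded_linear A" by (rule linear_continuous_imp_bounded_linear)
  then have L: "bounded_linear (inv A)" using assms(5) unfolding A_def by (rule bounded_linear_inv)
  have inv_A: "inv A (A y) = y" for y
    using assms(5) unfolding A_def by (simp add: bij_is_inj)
  \<comment> \<open>Composition with \<open>inv A\<close> leaves the zero set unchanged, so the
    implicit function of the normalised map also serves \<open>f\<close>.\<close>
  have inv_A_zero: "inv A z = 0 \<longleftrightarrow> z = 0" for z
    using assms(5) linear_simps(3)[OF L] unfolding A_def
    by (metis bij_is_surj surj_f_inv_f)
  have "dir_deriv (\<lambda>u. inv A (f u)) (t0, x0) (0, y) = y" for y
    using C1F_on_bounded_linear_compose(2)[OF assms(2) L assms(3)] inv_A by (simp add: A_eq)
  from implicit_function_near_identity[OF C1F_on_bounded_linear_compose(1)[OF assms(2) L] assms(3) _ this]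
  obtain V W g where *: "open V" "t0 \<in> V" "open W" "x0 \<in> W" "V \<times> W \<subseteq> U" "C1F_on V g" "g ` V \<subseteq> W"
    "g t0 = x0" "\<forall>t\<in>V. \<forall>x\<in>W. f (t, x) = 0 \<longleftrightarrow> x = g t"
    using assms(4) unfolding inv_A_zero by blast
  then show ?thesis by (intro exI[of _ V] exI[of _ W] exI[of _ g]) auto
qed

end
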